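(* Let $d\ge1$. Assume that for some $L>d+1$ there is a constant $C_L$ independent of $n$ such that $$|\Phi_n(x,y)|\le C_L\,n^{d}(1+n\rho(x,y))^{-L}\qquad\text{for all }x,y\in\mathbb S^d,\ n\ge1.$$ Let $r>d/2$, let $\{\mathcal X_m\}$ be a quasi-uniform sequence of QMC designs for $H^r(\mathbb S^d)$, and let $w_j=1/m$ for $1\le j\le m$. Let $C_2>0$. Then there is a constant $C>0$, independent of $m$, $n$ and $f$, such that $$\|\mathcal F_nf\|_{L^\infty}\le C\,\|f\|_{L^\infty}$$ for all $f\in C(\mathbb S^d)$ and all $m$ and $n\ge1$ with $n\le C_2\,m^{1/d}$.
   Context: $\mathbb S^d=\{x\in\mathbb R^{d+1}:|x|=1\}$ carries the normalized surface measure $\sigma$ ($\sigma(\mathbb S^d)=1$) and the geodesic distance $\rho(x,y)=\arccos(x\cdot y)$. For each $\ell\ge0$, $\{Y_{\ell,k}:1\le k\le Z(d,\ell)\}$ is an $L^2(\mathbb S^d,\sigma)$-orthonormal basis of the (real) spherical harmonics of degree $\ell$, and $\lambda_\ell=\ell(\ell+d-1)$. $H^r(\mathbb S^d)$ is the Sobolev space with norm $\|g\|_{H^r}^2=\sum_{\ell\ge0}(1+\lambda_\ell)^r\sum_k|\langle g,Y_{\ell,k}\rangle|^2$. Point sets $\mathcal X_m=\{x_j\}_{j=1}^m\subset\mathbb S^d$ are given for $m$ in an infinite set of integers $m\ge2$ (the points may depend on $m$). Mesh norm: $\delta_m=\sup_{x\in\mathbb S^d}\min_j\rho(x,x_j)$;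 separation radius: $\gamma_m=\tfrac12\min_{i\ne j}\rho(x_i,x_j)$; the sequence is quasi-uniform if $\delta_m\le C_0\gamma_m$ with $C_0$ independent of $m$. It is a sequence of QMC designs for $H^r(\mathbb S^d)$, $r>d/2$, if there is $C_1>0$ independent of $m$ with $$\sup_{\|g\|_{H^r}\le1}\left|\frac1m\sum_{j=1}^mg(x_j)-\int_{\mathbb S^d}g\,d\sigma\right|\le C_1m^{-r/d}.$$ For $n\ge1$ let $\eta_n:[0,\infty)\to\mathbb R$ be a spectral multiplier with kernel $\Phi_n(x,y)=\sum_{\ell\ge0}\eta_n(\lambda_\ell)\sum_kY_{\ell,k}(x)Y_{\ell,k}(y)$ (assumed to be a pointwise defined function), and define $\mathcal F_nf(x)=\sum_{j=1}^mw_jf(x_j)\Phi_n(x,x_j)$, which depends on both $m$ and $n$. *)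

theory Defs
  imports "HOL-Analysis.Analysis" "HOL-Probability.Essential_Supremum"
begin

text \<open>
  The sphere \<open>S^d\<close> is \<open>sphere 0 1\<close> in a Euclidean space of dimension \<open>d + 1\<close>.
  The parameter \<open>d\<close> below always denotes the dimension of the sphere.
\<close>

text \<open>
  The normalized surface measure, as the cone measure: the measure of \<open>A\<close> is the
  normalized volume of the part of the unit ball lying over \<open>A\<close>, that is of
  \<open>{x. sgn x \<in> A}\<close> with \<open>sgn x = x /\<^sub>R norm x\<close>.  The restriction makes the sphere itself the
  underlying space, so that values of functions off the sphere are irrelevant
  (for measurability as well); only the null set \<open>{0}\<close> of the ball is lost.
\<close>

definition sphere_measure :: "'a::euclidean_space measure" where
  "sphere_measure =
     restrict_space (distr (uniform_measure lborel (ball 0 1)) borel sgn) (sphere 0 1)"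

definition geodesic_dist :: "'a::euclidean_space \<Rightarrow> 'a \<Rightarrow> real" where
  "geodesic_dist x y = arccos (x \<bullet> y)"

definition L2_prod :: "('a::euclidean_space \<Rightarrow> real) \<Rightarrow> ('a \<Rightarrow> real) \<Rightarrow> real" where
  "L2_prod g h = (LINT x|sphere_measure. g x * h x)"

definition Linf_norm :: "('a::euclidean_space \<Rightarrow> real) \<Rightarrow> ereal" where
  "Linf_norm f = esssup sphere_measure (\<lambda>x. ereal \<bar>f x\<bar>)"

definition laplacian :: "('a::euclidean_space \<Rightarrow> real) \<Rightarrow> 'a \<Rightarrow> real" where
  "laplacian p x = (\<Sum>b\<in>Basis. (deriv ^^ 2) (\<lambda>t::real. p (x + t *\<^sub>R b)) 0)"

text \<open>Restrictions to the sphere of homogeneous harmonic polynomials of degree \<open>l\<close>.\<close>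

definition spherical_harmonic :: "nat \<Rightarrow> ('a::euclidean_space \<Rightarrow> real) \<Rightarrow> bool" where
  "spherical_harmonic l h \<longleftrightarrow>
     (\<exists>p. real_polynomial_function p \<and>
          (\<forall>t x. p (t *\<^sub>R x) = t ^ l * p x) \<and>
          (\<forall>x. laplacian p x = 0) \<and>
          (\<forall>x\<in>sphere 0 1. h x = p x))"

text \<open>
  For each degree \<open>l\<close>, the functions \<open>Y l 1, \<dots>, Y l (Z l)\<close> are an orthonormal basis of the
  spherical harmonics of degree \<open>l\<close>; this forces \<open>Z l\<close> to be the dimension of that space.
\<close>

definition harmonic_basis ::
    "(nat \<Rightarrow> nat) \<Rightarrow> (nat \<Rightarrow> nat \<Rightarrow> 'a::euclidean_space \<Rightarrow> real) \<Rightarrow> bool" where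
  "harmonic_basis Z Y \<longleftrightarrow>
     (\<forall>l. (\<forall>k\<in>{1..Z l}. spherical_harmonic l (Y l k)) \<and>
          (\<forall>j\<in>{1..Z l}. \<forall>k\<in>{1..Z l}. L2_prod (Y l j) (Y l k) = (if j = k then 1 else 0)) \<and>
          (\<forall>h. spherical_harmonic l h \<longrightarrow>
             (\<exists>c. \<forall>x\<in>sphere 0 1. h x = (\<Sum>k\<in>{1..Z l}. c k * Y l k x))))"

definition eigval :: "nat \<Rightarrow> nat \<Rightarrow> real" where
  "eigval d l = real l * (real l + real d - 1)"

definition sobolev_term ::
    "nat \<Rightarrow> (nat \<Rightarrow> nat) \<Rightarrow> (nat \<Rightarrow> nat \<Rightarrow> 'a::euclidean_space \<Rightarrow> real) \<Rightarrow> real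
       \<Rightarrow> ('a \<Rightarrow> real) \<Rightarrow> nat \<Rightarrow> real" where
  "sobolev_term d Z Y r g l =
     (1 + eigval d l) powr r * (\<Sum>k\<in>{1..Z l}. \<bar>L2_prod g (Y l k)\<bar>\<^sup>2)"

definition sobolev_space ::
    "nat \<Rightarrow> (nat \<Rightarrow> nat) \<Rightarrow> (nat \<Rightarrow> nat \<Rightarrow> 'a::euclidean_space \<Rightarrow> real) \<Rightarrow> real
       \<Rightarrow> ('a \<Rightarrow> real) set" where
  "sobolev_space d Z Y r =
     {g. g \<in> borel_measurable sphere_measure \<and>
         integrable sphere_measure (\<lambda>x. (g x)\<^sup>2) \<and>
         summable (sobolev_term d Z Y r g)}"

definition sobolev_norm ::
    "nat \<Rightarrow> (nat \<Rightarrow> nat) \<Rightarrow> (nat \<Rightarrow> nat \<Rightarrow> 'a::euclidean_space \<Rightarrow> real) \<Rightarrow> real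
       \<Rightarrow> ('a \<Rightarrow> real) \<Rightarrow> real" where
  "sobolev_norm d Z Y r g = sqrt (\<Sum>l. sobolev_term d Z Y r g l)"

definition mesh_norm :: "nat \<Rightarrow> (nat \<Rightarrow> 'a::euclidean_space) \<Rightarrow> real" where
  "mesh_norm m x = (SUP y\<in>sphere 0 1. Min ((\<lambda>j. geodesic_dist y (x j)) ` {1..m}))"

definition separation_radius :: "nat \<Rightarrow> (nat \<Rightarrow> 'a::euclidean_space) \<Rightarrow> real" where
  "separation_radius m x =
     1/2 * Min {geodesic_dist (x i) (x j) | i j. i \<in> {1..m} \<and> j \<in> {1..m} \<and> i \<noteq> j}"

definition quasi_uniform :: "nat set \<Rightarrow> (nat \<Rightarrow> nat \<Rightarrow> 'a::euclidean_space) \<Rightarrow> bool" where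
  "quasi_uniform M X \<longleftrightarrow>
     (\<exists>C0. \<forall>m\<in>M. mesh_norm m (X m) \<le> C0 * separation_radius m (X m))"

text \<open>
  Point evaluation on the Sobolev space (of order \<open>r > d/2\<close>) refers to the continuous
  representative, whence the continuity condition on \<open>g\<close>.
\<close>

definition worst_case_error ::
    "nat \<Rightarrow> (nat \<Rightarrow> nat) \<Rightarrow> (nat \<Rightarrow> nat \<Rightarrow> 'a::euclidean_space \<Rightarrow> real) \<Rightarrow> real
       \<Rightarrow> nat \<Rightarrow> (nat \<Rightarrow> 'a) \<Rightarrow> ereal" where
  "worst_case_error d Z Y r m x =
     (SUP g\<in>{g \<in> sobolev_space d Z Y r. continuous_on (sphere 0 1) g \<and> sobolev_norm d Z Y r g \<le> 1}.
        ereal \<bar>1 / real m * (\<Sum>j\<in>{1..m}. g (x j)) - (LINT y|sphere_measure. g y)\<bar>)"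

definition qmc_designs ::
    "nat \<Rightarrow> (nat \<Rightarrow> nat) \<Rightarrow> (nat \<Rightarrow> nat \<Rightarrow> 'a::euclidean_space \<Rightarrow> real) \<Rightarrow> real
       \<Rightarrow> nat set \<Rightarrow> (nat \<Rightarrow> nat \<Rightarrow> 'a) \<Rightarrow> bool" where
  "qmc_designs d Z Y r M X \<longleftrightarrow>
     (\<exists>C1>0. \<forall>m\<in>M. worst_case_error d Z Y r m (X m) \<le> ereal (C1 * real m powr (- r / real d)))"

definition kernel_term ::
    "nat \<Rightarrow> (nat \<Rightarrow> nat) \<Rightarrow> (nat \<Rightarrow> nat \<Rightarrow> 'a::euclidean_space \<Rightarrow> real) \<Rightarrow> (real \<Rightarrow> real)
       \<Rightarrow> 'a \<Rightarrow> 'a \<Rightarrow> nat \<Rightarrow> real" where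
  "kernel_term d Z Y \<eta> x y l = \<eta> (eigval d l) * (\<Sum>k\<in>{1..Z l}. Y l k x * Y l k y)"

definition multiplier_kernel ::
    "nat \<Rightarrow> (nat \<Rightarrow> nat) \<Rightarrow> (nat \<Rightarrow> nat \<Rightarrow> 'a::euclidean_space \<Rightarrow> real) \<Rightarrow> (real \<Rightarrow> real)
       \<Rightarrow> 'a \<Rightarrow> 'a \<Rightarrow> real" where
  "multiplier_kernel d Z Y \<eta> x y = (\<Sum>l. kernel_term d Z Y \<eta> x y l)"

definition discrete_filter ::
    "nat \<Rightarrow> (nat \<Rightarrow> nat) \<Rightarrow> (nat \<Rightarrow> nat \<Rightarrow> 'a::euclidean_space \<Rightarrow> real) \<Rightarrow> (real \<Rightarrow> real)
       \<Rightarrow> nat \<Rightarrow> (nat \<Rightarrow> 'a) \<Rightarrow> (nat \<Rightarrow> real) \<Rightarrow> ('a \<Rightarrow> real) \<Rightarrow> 'a \<Rightarrow> real" where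
  "discrete_filter d Z Y \<eta> m x w f y =
     (\<Sum>j\<in>{1..m}. w j * f (x j) * multiplier_kernel d Z Y \<eta> y (x j))"

end

theory Submission
  imports Defs
begin

text \<open>
  Covering a thin spherical shell by balls around the nodes shows that the mesh norm, hence by
  quasi-uniformity the separation radius, is at least of order \<open>m powr (- 1 / d)\<close>.
  A packing argument then bounds the number of nodes in a cap of radius \<open>(k + 1) / n\<close>, and
  summation over the shells \<open>k \<le> n * dist y (x j) < k + 1\<close> shows that the means
  \<open>(1 / m) * (\<Sum>j. \<bar>\<Phi> y (x j)\<bar>)\<close> are bounded uniformly in \<open>y\<close>, \<open>m\<close> and \<open>n\<close>.
\<close>

section \<open>Comparison of geodesic and Euclidean distance\<close>

lemma jordan_inequality:
  fixes t :: real
  assumes "0 \<le> t" "t \<le> pi / 2"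
  shows "2 / pi * t \<le> sin t"
proof -
  have "concave_on {0..pi/2} (sin :: real \<Rightarrow> real)"
    by (rule f''_le0_imp_concave[where f'=cos and f''="\<lambda>x. - sin x"])
       (auto intro!: derivative_eq_intros sin_ge_zero)
  from concave_onD[OF this, of "2 * t / pi" 0 "pi/2"] show ?thesis
    using assms by (simp add: field_simps)
qed

text \<open>The chord is \<open>2 * sin t\<close> with \<open>t\<close> half the angle. Then
  \<open>sin t \<le> t\<close> gives one bound; the Jordan inequality, weakened to
  \<open>t / 2 \<le> sin t\<close> by \<open>pi < 4\<close>, gives the other.\<close>

lemma
  fixes x y :: "'a::euclidean_space"
  assumes "x \<in> sphere 0 1" "y \<in> sphere 0 1"
  shows dist_le_geodesic_dist: "dist x y \<le> geodesic_dist x y"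
    and geodesic_dist_le_dist: "geodesic_dist x y \<le> 2 * dist x y"
proof -
  define t where "t = geodesic_dist x y / 2"
  have "\<bar>x \<bullet> y\<bar> \<le> 1"
    using Cauchy_Schwarz_ineq2[of x y] assms by simp
  then have t: "0 \<le> t" "t \<le> pi / 2" and "cos (2 * t) = x \<bullet> y"
    unfolding t_def geodesic_dist_def
    using arccos_lbound[of "x \<bullet> y"] arccos_ubound[of "x \<bullet> y"] by (auto simp: cos_arccos_abs)
  moreover have "x \<bullet> x = 1" "y \<bullet> y = 1"
    using assms by (simp_all add: norm_eq_1)
  ultimately have "(dist x y)\<^sup>2 = (2 * sin t)\<^sup>2"
    unfolding dist_norm power2_norm_eq_inner cos_double_sin
    by (simp add: inner_diff inner_commute power2_eq_square)
  moreover have "0 \<le> sin t"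
    using t by (intro sin_ge_zero) auto
  ultimately have d: "dist x y = 2 * sin t"
    using power2_eq_imp_eq[of "dist x y" "2 * sin t"] by simp
  show "dist x y \<le> geodesic_dist x y"
    using d sin_x_le_x[OF t(1)] by (simp add: t_def)
  have "1 / 2 \<le> 2 / pi"
    using pi_less_4 by (simp add: field_simps)
  then have "t / 2 \<le> sin t"
    using jordan_inequality[OF t] mult_right_mono[of "1 / 2" "2 / pi" t] t(1) by simp
  then show "geodesic_dist x y \<le> 2 * dist x y"
    using d by (simp add: t_def)
qed

lemma geodesic_dist_nonneg:
  fixes x y :: "'a::euclidean_space"
  assumes "x \<in> sphere 0 1" "y \<in> sphere 0 1"
  shows "0 \<le> geodesic_dist x y"
  using dist_le_geodesic_dist[OF assms] zero_le_dist[of x y] by linarith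

lemma geodesic_dist_le_4:
  fixes x y :: "'a::euclidean_space"
  assumes "x \<in> sphere 0 1" "y \<in> sphere 0 1"
  shows "geodesic_dist x y \<le> 4"
  using geodesic_dist_le_dist[OF assms] norm_triangle_ineq4[of x y] assms
  by (simp add: dist_norm)

section \<open>Packing of separated points\<close>

lemma fmeasurable_lborel_ball [simp]:
  fixes x :: "'a::euclidean_space"
  shows "ball x r \<in> fmeasurable lborel" "cball x r \<in> fmeasurable lborel"
  by (auto intro!: fmeasurableI emeasure_bounded_finite)

text \<open>Volume comparison: the balls of radius \<open>s / 2\<close> about the points are
  disjoint and lie in the ball of radius \<open>R + s / 2\<close> about \<open>x\<close>.\<close>

lemma card_separated_le:
  fixes p :: "'i \<Rightarrow> 'a::euclidean_space"
  assumes J: "finite J" and s: "s > 0" and R: "R \<ge> 0"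
    and sep: "\<And>i j. i \<in> J \<Longrightarrow> j \<in> J \<Longrightarrow> i \<noteq> j \<Longrightarrow> s \<le> dist (p i) (p j)"
    and near: "\<And>i. i \<in> J \<Longrightarrow> dist x (p i) \<le> R"
  shows "real (card J) \<le> (1 + 2 * R / s) ^ DIM('a)"
proof -
  let ?v = "unit_ball_vol (real DIM('a))"
  have "disjnt (ball (p i) (s / 2)) (ball (p j) (s / 2))" if "i \<in> J" "j \<in> J" "i \<noteq> j" for i j
    unfolding disjnt_def
  proof (rule ccontr)
    assume "ball (p i) (s / 2) \<inter> ball (p j) (s / 2) \<noteq> {}"
    then obtain z where "dist (p i) z < s / 2" "dist (p j) z < s / 2"
      by auto
    then show False
      using sep[OF that] dist_triangle2[of "p i" "p j" z] by linarith
  qed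
  then have "measure lborel (\<Union>i\<in>J. ball (p i) (s / 2)) = (\<Sum>i\<in>J. measure lborel (ball (p i) (s / 2)))"
    by (intro measure_UNION' J) (auto simp: pairwise_def)
  also have "\<dots> = real (card J) * (?v * (s / 2) ^ DIM('a))"
    using s by (simp add: content_ball)
  finally have "real (card J) * (?v * (s / 2) ^ DIM('a)) = measure lborel (\<Union>i\<in>J. ball (p i) (s / 2))" ..
  also have "\<dots> \<le> measure lborel (ball x (R + s / 2))"
  proof (intro measure_mono_fmeasurable)
    show "(\<Union>i\<in>J. ball (p i) (s / 2)) \<subseteq> ball x (R + s / 2)"
    proof
      fix z assume "z \<in> (\<Union>i\<in>J. ball (p i) (s / 2))"
      then obtain i where "i \<in> J" "dist (p i) z < s / 2"
        by auto
      then show "z \<in> ball x (R + s / 2)"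
        using near[of i] dist_triangle[of x z "p i"] by simp
    qed
    show "(\<Union>i\<in>J. ball (p i) (s / 2)) \<in> sets lborel"
      by (simp add: open_UN)
  qed simp
  also have "\<dots> = ?v * (R + s / 2) ^ DIM('a)"
    using s R by (simp add: content_ball)
  also have "R + s / 2 = (1 + 2 * R / s) * (s / 2)"
    using s by (simp add: field_simps)
  finally have "real (card J) * (?v * (s / 2) ^ DIM('a))
      \<le> (1 + 2 * R / s) ^ DIM('a) * (?v * (s / 2) ^ DIM('a))"
    by (simp only: power_mult_distrib mult_ac)
  moreover have "0 < ?v * (s / 2) ^ DIM('a)"
    using s by (simp add: unit_ball_vol_pos)
  ultimately show ?thesis
    by (simp only: mult_le_cancel_right_pos)
qed

text \<open>The squared distance of the scaled points is \<open>(a - b)\<^sup>2\<close> plus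
  \<open>a * b\<close> times the squared chord. Both summands are nonnegative and
  \<open>a * b \<ge> 1\<close>, so each bound keeps one of them. This separates radial copies of
  points.\<close>

lemma dist_scaleR_sphere_ge:
  fixes x y :: "'a::euclidean_space"
  assumes "x \<in> sphere 0 1" "y \<in> sphere 0 1" "a \<ge> 1" "b \<ge> 1"
  shows "\<bar>a - b\<bar> \<le> dist (a *\<^sub>R x) (b *\<^sub>R y)" and "dist x y \<le> dist (a *\<^sub>R x) (b *\<^sub>R y)"
proof -
  have xy: "x \<bullet> x = 1" "y \<bullet> y = 1"
    using assms by (simp_all add: norm_eq_1)
  have xy_le: "x \<bullet> y \<le> 1"
    using norm_cauchy_schwarz[of x y] assms by simp
  have d: "(dist (a *\<^sub>R x) (b *\<^sub>R y))\<^sup>2 = (a - b)\<^sup>2 + a * b * (2 * (1 - x \<bullet> y))"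
    and d1: "(dist x y)\<^sup>2 = 2 * (1 - x \<bullet> y)"
    using xy unfolding dist_norm power2_norm_eq_inner
    by (simp_all add: inner_diff inner_commute power2_eq_square algebra_simps)
  have ab: "1 * 1 \<le> a * b"
    using assms by (intro mult_mono) auto
  have "(a - b)\<^sup>2 \<le> (dist (a *\<^sub>R x) (b *\<^sub>R y))\<^sup>2"
    using xy_le ab unfolding d by simp
  then show "\<bar>a - b\<bar> \<le> dist (a *\<^sub>R x) (b *\<^sub>R y)"
    using abs_le_square_iff[of "a - b" "dist (a *\<^sub>R x) (b *\<^sub>R y)"] by simp
  have "1 * (2 * (1 - x \<bullet> y)) \<le> a * b * (2 * (1 - x \<bullet> y))"
    using xy_le ab by (intro mult_right_mono) auto
  then have "(dist x y)\<^sup>2 \<le> (dist (a *\<^sub>R x) (b *\<^sub>R y))\<^sup>2"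
    unfolding d d1 using zero_le_power2[of "a - b"] by linarith
  then show "dist x y \<le> dist (a *\<^sub>R x) (b *\<^sub>R y)"
    by (rule power2_le_imp_le) simp
qed

text \<open>
  Stacking about \<open>t / s\<close> radial copies of the points turns the packing bound of order
  \<open>(t / s) ^ (d + 1)\<close> in the ambient space into one of order \<open>(t / s) ^ d\<close> on the sphere.
\<close>

lemma card_separated_cap_le:
  fixes p :: "'i \<Rightarrow> 'a::euclidean_space"
  assumes J: "finite J" and s: "s > 0" "s \<le> t" and dim: "DIM('a) = d + 1"
    and x: "x \<in> sphere 0 1" and p: "\<And>i. i \<in> J \<Longrightarrow> p i \<in> sphere 0 1"
    and sep: "\<And>i j. i \<in> J \<Longrightarrow> j \<in> J \<Longrightarrow> i \<noteq> j \<Longrightarrow> s \<le> dist (p i) (p j)"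
    and near: "\<And>i. i \<in> J \<Longrightarrow> dist x (p i) \<le> t"
  shows "real (card J) \<le> 2 * 5 ^ (d + 1) * (t / s) ^ d"
proof -
  \<comment> \<open>As many layers, spaced by \<open>s\<close>, as fit into radial depth
    \<open>t\<close>.\<close>
  define N where "N = nat \<lfloor>t / s\<rfloor>"
  have ts: "1 \<le> t / s"
    using s by simp
  have N: "real N \<le> t / s" "t / s < 2 * real N"
  proof -
    have "1 \<le> N" "t / s < real N + 1"
      unfolding N_def using ts by linarith+
    then show "t / s < 2 * real N" by linarith
    show "real N \<le> t / s"
      unfolding N_def using ts by linarith
  qed
  define q where "q = (\<lambda>(j, i::nat). (1 + real i * s) *\<^sub>R p j)"
  \<comment> \<open>The radius is \<open>2 * t\<close>: at most \<open>t\<close> from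
    \<open>x\<close> to \<open>p j\<close>, and at most \<open>t\<close> for the radial
    shift.\<close>
  have "real (card (J \<times> {..<N})) \<le> (1 + 2 * (2 * t) / s) ^ DIM('a)"
  proof (rule card_separated_le[where p = q and x = x])
    fix u v assume uv: "u \<in> J \<times> {..<N}" "v \<in> J \<times> {..<N}" "u \<noteq> v"
    obtain j i k l where u: "u = (j, i)" and v: "v = (k, l)"
      by (cases u, cases v)
    have jk: "j \<in> J" "k \<in> J"
      using uv u v by auto
    note D = dist_scaleR_sphere_ge[OF p[OF jk(1)] p[OF jk(2)], of "1 + real i * s" "1 + real l * s"]
    show "s \<le> dist (q u) (q v)"
    proof (cases "i = l")
      case True
      then show ?thesis
        using D(2) sep[OF jk] uv u v s by (auto simp: q_def)
    next
      case False
      then have "1 \<le> \<bar>real i - real l\<bar>"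
        by linarith
      then have "s \<le> \<bar>real i - real l\<bar> * s"
        using s by simp
      also have "\<dots> = \<bar>(1 + real i * s) - (1 + real l * s)\<bar>"
        using s by (simp add: abs_mult flip: left_diff_distrib)
      finally show ?thesis
        using D(1) u v s by (simp add: q_def)
    qed
  next
    fix u assume u: "u \<in> J \<times> {..<N}"
    obtain j i where u': "u = (j, i)"
      by (cases u)
    have ji: "j \<in> J" "i < N"
      using u u' by auto
    have "dist (p j) (q u) = real i * s"
      using p[OF ji(1)] s unfolding u' q_def dist_norm by (simp add: algebra_simps)
    also have "\<dots> \<le> real N * s"
      using ji s by simp
    also have "\<dots> \<le> t"
      using N(1) s by (simp add: field_simps)
    finally show "dist x (q u) \<le> 2 * t"
      using near[OF ji(1)] dist_triangle[of x "q u" "p j"] by linarith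
  qed (use J s in auto)
  then have "real (card J) * real N \<le> (1 + 4 * (t / s)) ^ (d + 1)"
    by (simp add: card_cartesian_product dim)
  also have "\<dots> \<le> (5 * (t / s)) ^ (d + 1)"
    using ts by (intro power_mono) auto
  finally have *: "real (card J) * real N \<le> (5 * (t / s)) ^ (d + 1)" .
  \<comment> \<open>Since \<open>N\<close> exceeds half of \<open>t / s\<close>, dividing by the
    number of layers removes one power of \<open>t / s\<close> at the cost of a factor 2.\<close>
  have "real (card J) * (t / s) \<le> real (card J) * (2 * real N)"
    using N by (intro mult_left_mono) auto
  also have "\<dots> \<le> 2 * (5 * (t / s)) ^ (d + 1)"
    using * by simp
  also have "\<dots> = (2 * 5 ^ (d + 1) * (t / s) ^ d) * (t / s)"
    by (simp only: power_mult_distrib power_add power_one_right mult_ac)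
  finally show ?thesis
    using ts by (subst (asm) mult_le_cancel_right_pos) auto
qed

lemma summable_real_powr_shift:
  assumes "e < -1"
  shows "summable (\<lambda>k. real (k + 1) powr e)"
  using assms summable_iff_shift[of "\<lambda>k. real k powr e" 1] by (simp add: summable_real_powr_iff)

text \<open>Points are sorted into shells by the integer part of \<open>a * dist x (p j)\<close>.
  The cap bound leaves at most order \<open>(k + 1) ^ d\<close> points in shell \<open>k\<close>,
  and \<open>L > d + 1\<close> makes the series of \<open>(k + 1) powr (d - L)\<close>
  converge.\<close>

lemma sum_decay_separated_le:
  fixes p :: "'i \<Rightarrow> 'a::euclidean_space"
  assumes J: "finite J" and s: "s > 0" and a: "a > 0" and dim: "DIM('a) = d + 1"
    and L: "L > real d + 1"
    and x: "x \<in> sphere 0 1" and p: "\<And>i. i \<in> J \<Longrightarrow> p i \<in> sphere 0 1"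
    and sep: "\<And>i j. i \<in> J \<Longrightarrow> j \<in> J \<Longrightarrow> i \<noteq> j \<Longrightarrow> s \<le> dist (p i) (p j)"
  shows "(\<Sum>j\<in>J. (1 + a * dist x (p j)) powr (- L))
           \<le> 2 * 5 ^ (d + 1) * (1 + 1 / (a * s)) ^ d * (\<Sum>k. real (k + 1) powr (real d - L))"
proof -
  define K where "K = 2 * 5 ^ (d + 1) * (1 + 1 / (a * s)) ^ d"
  have K: "K \<ge> 0"
    using a s by (simp add: K_def)
  define h where "h j = nat \<lfloor>a * dist x (p j)\<rfloor>" for j
  have h: "real (h j) \<le> a * dist x (p j)" "a * dist x (p j) < real (h j + 1)" for j
  proof -
    have "0 \<le> a * dist x (p j)"
      using a by simp
    then show "real (h j) \<le> a * dist x (p j)" "a * dist x (p j) < real (h j + 1)"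
      unfolding h_def by linarith+
  qed
  have card: "real (card {j \<in> J. h j = k}) \<le> K * real (k + 1) ^ d" for k
  proof -
    \<comment> \<open>The outer radius of the shell, enlarged by \<open>1 + a * s\<close> so that
      the cap bound's condition \<open>s \<le> t\<close> also holds for large
      \<open>a * s\<close>.\<close>
    define t where "t = real (k + 1) / a * (1 + a * s)"
    have "real (k + 1) / a \<le> t"
      using mult_left_mono[of 1 "1 + a * s" "real (k + 1) / a"] a s by (simp add: t_def)
    moreover have "s \<le> t"
      using a s unfolding t_def by (simp add: field_simps)
    ultimately have "real (card {j \<in> J. h j = k}) \<le> 2 * 5 ^ (d + 1) * (t / s) ^ d"
    proof (intro card_separated_cap_le[where x = x and p = p] dim)
      fix i assume i: "i \<in> {j \<in> J. h j = k}"
      have "dist x (p i) \<le> real (k + 1) / a"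
        using h(2)[of i] i a by (simp add: field_simps)
      also assume "real (k + 1) / a \<le> t"
      finally show "dist x (p i) \<le> t" .
    qed (use J s x p sep in auto)
    also have "t / s = (1 + 1 / (a * s)) * real (k + 1)"
      using a s by (simp add: t_def field_simps)
    finally show ?thesis
      by (simp add: K_def power_mult_distrib mult_ac)
  qed
  have summ: "summable (\<lambda>k. real (k + 1) powr (real d - L))"
    using L by (intro summable_real_powr_shift) simp
  have "(\<Sum>j\<in>J. (1 + a * dist x (p j)) powr (- L)) \<le> (\<Sum>j\<in>J. real (h j + 1) powr (- L))"
    using h(1) L by (intro sum_mono powr_mono2') auto
  also have "\<dots> = (\<Sum>k\<in>h ` J. \<Sum>j\<in>{j \<in> J. h j = k}. real (h j + 1) powr (- L))"
    by (rule sum.image_gen[OF J])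
  also have "\<dots> = (\<Sum>k\<in>h ` J. real (card {j \<in> J. h j = k}) * real (k + 1) powr (- L))"
    by (intro sum.cong refl) simp
  also have "\<dots> \<le> (\<Sum>k\<in>h ` J. (K * real (k + 1) ^ d) * real (k + 1) powr (- L))"
    by (intro sum_mono mult_right_mono card) simp
  also have "\<dots> = K * (\<Sum>k\<in>h ` J. real (k + 1) powr (real d - L))"
    by (simp add: sum_distrib_left mult.assoc powr_add[symmetric] powr_realpow[symmetric]
        del: of_nat_add of_nat_Suc)
  also have "\<dots> \<le> K * (\<Sum>k. real (k + 1) powr (real d - L))"
    using J K summ by (intro mult_left_mono sum_le_suminf) auto
  finally show ?thesis
    by (simp add: K_def)
qed

section \<open>Lower bound for the mesh norm\<close>

text \<open>For \<open>t < 1\<close>, the shell of thickness \<open>t\<close> inside the unit sphere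
  has volume at least \<open>t\<close> times that of the unit ball. Balls of radius
  \<open>2 * t\<close> about the nodes cover it, because radial projection to the sphere moves its
  points by at most \<open>t\<close>. Cancelling one factor \<open>t\<close> leaves the exponent
  \<open>d\<close>.\<close>

lemma covering_radius_ge:
  fixes x :: "'i \<Rightarrow> 'a::euclidean_space"
  assumes J: "finite J" and t: "t > 0" and dim: "DIM('a) = d + 1"
    and cov: "\<And>y. y \<in> sphere 0 1 \<Longrightarrow> \<exists>j\<in>J. dist y (x j) \<le> t"
  shows "1 \<le> real (card J) * (2 ^ (d + 1) * t ^ d)"
proof (cases "t < 1")
  case True
  let ?v = "unit_ball_vol (real DIM('a))"
  have "(1 - t) ^ (d + 1) \<le> (1 - t) ^ 1"
    using t True by (intro power_decreasing) auto
  then have "?v * t \<le> ?v * (1 - (1 - t) ^ (d + 1))"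
    by (intro mult_left_mono) (auto simp: less_imp_le)
  also have "\<dots> = measure lborel (ball (0::'a) 1 - ball 0 (1 - t))"
    using t True
    by (subst measurable_measure_Diff)
      (auto simp: content_ball dim algebra_simps)
  also have "\<dots> \<le> measure lborel (\<Union>j\<in>J. cball (x j) (2 * t))"
  proof (intro measure_mono_fmeasurable)
    show "ball 0 1 - ball 0 (1 - t) \<subseteq> (\<Union>j\<in>J. cball (x j) (2 * t))"
    proof
      fix y :: 'a assume "y \<in> ball 0 1 - ball 0 (1 - t)"
      then have y: "norm y < 1" "1 - t \<le> norm y" "y \<noteq> 0"
        using True by auto
      then have "sgn y \<in> sphere 0 1"
        by (simp add: norm_sgn)
      then obtain j where j: "j \<in> J" "dist (sgn y) (x j) \<le> t"
        using cov by blast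
      have "dist y (sgn y) = norm ((norm y - 1) *\<^sub>R sgn y)"
        using y by (simp add: dist_norm sgn_div_norm algebra_simps)
      also have "\<dots> = 1 - norm y"
        using y by (simp add: norm_sgn)
      finally have "dist (x j) y \<le> 2 * t"
        using j(2) y dist_triangle[of y "x j" "sgn y"] by (simp add: dist_commute)
      then show "y \<in> (\<Union>j\<in>J. cball (x j) (2 * t))"
        using j(1) by auto
    qed
    show "(\<Union>j\<in>J. cball (x j) (2 * t)) \<in> fmeasurable lborel"
      using J by (intro fmeasurable.finite_UN) auto
  qed auto
  also have "\<dots> \<le> (\<Sum>j\<in>J. measure lborel (cball (x j) (2 * t)))"
    by (intro measure_UNION_le J) auto
  also have "\<dots> = ?v * (real (card J) * (2 * t) ^ (d + 1))"
    using t by (simp add: content_cball dim)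
  finally have "t \<le> real (card J) * (2 * t) ^ (d + 1)"
    by (subst (asm) mult_le_cancel_left_pos) auto
  also have "\<dots> = (real (card J) * (2 ^ (d + 1) * t ^ d)) * t"
    by (simp add: power_mult_distrib mult_ac)
  finally have "1 * t \<le> (real (card J) * (2 ^ (d + 1) * t ^ d)) * t"
    by simp
  then show ?thesis
    using t by (subst (asm) mult_le_cancel_right_pos) auto
next
  case False
  \<comment> \<open>For \<open>t \<ge> 1\<close> a nonempty \<open>J\<close> suffices; a basis
    vector is a point of the sphere that has to be covered.\<close>
  obtain b :: 'a where "b \<in> Basis"
    using nonempty_Basis by blast
  then have "J \<noteq> {}"
    using cov[of b] by auto
  then have "1 \<le> card J"
    using J by (simp add: Suc_leI card_gt_0_iff)
  then have "1 * (1 * 1) \<le> real (card J) * (2 ^ (d + 1) * t ^ d)"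
    using False by (intro mult_mono one_le_power) auto
  then show ?thesis by simp
qed

text \<open>The constant 8 makes the covering bound fail: a mesh norm below \<open>t\<close> would
  give \<open>1 \<le> 2 * (2 / 8) ^ d\<close>, which is at most 1/2.\<close>

lemma mesh_norm_ge:
  fixes x :: "nat \<Rightarrow> 'a::euclidean_space"
  assumes "d \<ge> 1" and dim: "DIM('a) = d + 1" and m: "m \<ge> 1"
    and x: "\<And>j. j \<in> {1..m} \<Longrightarrow> x j \<in> sphere 0 1"
  shows "real m powr (- 1 / real d) / 8 \<le> mesh_norm m x"
proof (rule ccontr)
  define t where "t = real m powr (- 1 / real d) / 8"
  assume "\<not> real m powr (- 1 / real d) / 8 \<le> mesh_norm m x"
  then have mesh: "mesh_norm m x < t"
    by (simp add: t_def)
  have t: "t > 0"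
    using m by (simp add: t_def)
  have "t ^ d = 1 / (real m * 8 ^ d)"
    using m assms(1) by (simp add: t_def power_divide powr_power powr_minus_divide)
  have "\<exists>j\<in>{1..m}. dist y (x j) \<le> t" if y: "y \<in> sphere 0 1" for y
  proof -
    let ?D = "\<lambda>y. (\<lambda>j. geodesic_dist y (x j)) ` {1..m}"
    \<comment> \<open>A crude upper bound, needed because the real supremum dominates its members
      only for bounded families.\<close>
    have "Min (?D z) \<le> 4" if "z \<in> sphere 0 1" for z
      using m x[of 1] geodesic_dist_le_4[OF that, of "x 1"]
      by (intro order_trans[OF Min_le[of _ "geodesic_dist z (x 1)"]]) auto
    then have "bdd_above ((\<lambda>y. Min (?D y)) ` sphere 0 1)"
      by (intro bdd_aboveI2)
    then have "Min (?D y) \<le> mesh_norm m x"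
      unfolding mesh_norm_def by (intro cSUP_upper y)
    moreover have "Min (?D y) \<in> ?D y"
      using m by (intro Min_in) auto
    ultimately obtain j where j: "j \<in> {1..m}" "geodesic_dist y (x j) \<le> mesh_norm m x"
      by auto
    then show ?thesis
      using dist_le_geodesic_dist[OF y x[OF j(1)]] mesh by (intro bexI[of _ j]) auto
  qed
  from covering_radius_ge[OF _ t dim this]
  have "1 \<le> real m * (2 ^ (d + 1) * t ^ d)"
    by simp
  also have "\<dots> = 2 * (1 / 4) ^ d"
    using m by (simp add: \<open>t ^ d = _\<close> power_divide field_simps flip: power_mult_distrib)
  also have "\<dots> \<le> 2 * (1 / 4) ^ 1"
    using assms(1) by (intro mult_left_mono power_decreasing) auto
  finally show False by simp
qed

section \<open>Separation radius\<close>

text \<open>The factor 1/2 in the radius absorbs the factor 2 between geodesic distance and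
  chord.\<close>

lemma separation_radius_le_dist:
  fixes x :: "nat \<Rightarrow> 'a::euclidean_space"
  assumes ij: "i \<in> {1..m}" "j \<in> {1..m}" "i \<noteq> j"
    and x: "\<And>j. j \<in> {1..m} \<Longrightarrow> x j \<in> sphere 0 1"
  shows "separation_radius m x \<le> dist (x i) (x j)"
proof -
  let ?S = "{geodesic_dist (x i) (x j) | i j. i \<in> {1..m} \<and> j \<in> {1..m} \<and> i \<noteq> j}"
  have "finite ?S"
    by (rule finite_subset[of _ "(\<lambda>(i, j). geodesic_dist (x i) (x j)) ` ({1..m} \<times> {1..m})"]) auto
  then have "Min ?S \<le> geodesic_dist (x i) (x j)"
    using ij by (intro Min_le) auto
  then show ?thesis
    using geodesic_dist_le_dist[OF x[OF ij(1)] x[OF ij(2)]] by (simp add: separation_radius_def)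
qed

text \<open>With two nodes, \<open>Min\<close> ranges over a nonempty set and is attained. The sign
  permits enlarging the quasi-uniformity constant, whose own sign is unknown.\<close>

lemma separation_radius_nonneg:
  fixes x :: "nat \<Rightarrow> 'a::euclidean_space"
  assumes "m \<ge> 2" and x: "\<And>j. j \<in> {1..m} \<Longrightarrow> x j \<in> sphere 0 1"
  shows "0 \<le> separation_radius m x"
proof -
  let ?S = "{geodesic_dist (x i) (x j) | i j. i \<in> {1..m} \<and> j \<in> {1..m} \<and> i \<noteq> j}"
  have "finite ?S"
    by (rule finite_subset[of _ "(\<lambda>(i, j). geodesic_dist (x i) (x j)) ` ({1..m} \<times> {1..m})"]) auto
  moreover have "geodesic_dist (x 1) (x 2) \<in> ?S"
    using assms(1) by (intro CollectI exI[of _ 1] exI[of _ 2]) auto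
  ultimately have "Min ?S \<in> ?S"
    by (intro Min_in) auto
  then obtain i j where "i \<in> {1..m}" "j \<in> {1..m}" "Min ?S = geodesic_dist (x i) (x j)"
    by blast
  then show ?thesis
    using geodesic_dist_nonneg[OF x x, of i j] by (simp add: separation_radius_def)
qed

section \<open>Surface measure and the essential supremum\<close>

lemma space_sphere_measure [simp]: "space sphere_measure = sphere 0 1"
  by (simp add: sphere_measure_def space_restrict_space)

lemma borel_measurable_sphere_measure_continuous:
  fixes f :: "'a::euclidean_space \<Rightarrow> 'b::topological_space"
  assumes "continuous_on (sphere 0 1) f"
  shows "f \<in> borel_measurable sphere_measure"
proof -
  have "sets (sphere_measure :: 'a measure) = sets (restrict_space borel (sphere 0 1))"
    unfolding sphere_measure_def by (intro sets_restrict_space_cong) simp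
  then show ?thesis
    using borel_measurable_continuous_on_restrict[OF assms] by (simp cong: measurable_cong_sets)
qed

text \<open>The surface measure has full support: the cone over a relatively open nonempty set meets
  the unit ball in a nonempty open set, which is not Lebesgue null.\<close>

lemma AE_sphere_measure_not_open:
  fixes U :: "'a::euclidean_space set"
  assumes U: "open U" and x: "x \<in> sphere 0 1" "x \<in> U"
    and ae: "AE y in sphere_measure. y \<notin> U"
  shows False
proof -
  have pred: "{y \<in> space borel. y \<in> sphere 0 1 \<longrightarrow> y \<notin> U} \<in> sets borel"
  proof -
    have "{y \<in> space borel. y \<in> sphere 0 1 \<longrightarrow> y \<notin> U} = - (sphere 0 1 \<inter> U)"
      by auto
    then show ?thesis
      using U by (auto intro!: borel_closed borel_open)
  qed
  have ball: "emeasure lborel (ball (0::'a) 1) \<noteq> 0" "emeasure lborel (ball (0::'a) 1) < \<infinity>"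
    using unit_ball_vol_pos[of "real DIM('a)", THEN less_imp_neq] by (simp_all add: emeasure_ball)
  \<comment> \<open>Restriction, push-forward under \<open>sgn\<close> and conditioning on the ball
    are undone in turn, leaving a statement about Lebesgue measure.\<close>
  have "AE y in distr (uniform_measure lborel (ball 0 1)) borel sgn. y \<in> sphere 0 1 \<longrightarrow> y \<notin> U"
    using ae unfolding sphere_measure_def by (subst (asm) AE_restrict_space_iff) auto
  then have "AE z in lborel. z \<in> ball 0 1 \<longrightarrow> sgn z \<in> sphere 0 1 \<longrightarrow> sgn z \<notin> U"
    using pred by (subst (asm) AE_distr_iff, simp, simp) (subst (asm) AE_uniform_measure[OF ball], simp)
  then obtain N where N: "N \<in> null_sets lborel"
      "\<And>z. z \<notin> N \<Longrightarrow> z \<in> ball 0 1 \<longrightarrow> sgn z \<in> sphere 0 1 \<longrightarrow> sgn z \<notin> U"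
    by (auto elim!: AE_E3)
  define V where "V = (ball 0 1 - {0}) \<inter> sgn -` U"
  have "continuous_on (ball (0::'a) 1 - {0}) sgn"
    by (intro continuous_on_sgn continuous_intros) auto
  then have "open V"
    unfolding V_def by (intro continuous_open_preimage U open_Diff) auto
  moreover have "x /\<^sub>R 2 \<in> V"
    using x by (auto simp: V_def sgn_scaleR) (simp add: sgn_div_norm)
  moreover have "V \<subseteq> N"
  proof
    fix z assume "z \<in> V"
    then show "z \<in> N"
      using N(2)[of z] by (auto simp: V_def norm_sgn)
  qed
  then have "negligible V"
    using N(1) by (meson negligible_iff_null_sets negligible_subset null_sets_completionI)
  ultimately show False
    using open_not_negligible by blast
qed

text \<open>The filter samples \<open>f\<close> at single nodes, so pointwise control is required.
  The points where \<bar>f\<bar> exceeds its essential supremum form a relatively open null set,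
  hence none exist.\<close>

lemma continuous_le_Linf_norm:
  fixes f :: "'a::euclidean_space \<Rightarrow> real"
  assumes f: "continuous_on (sphere 0 1) f" and x: "x \<in> sphere 0 1"
  shows "ereal \<bar>f x\<bar> \<le> Linf_norm f"
proof (rule ccontr)
  assume "\<not> ereal \<bar>f x\<bar> \<le> Linf_norm f"
  then have less: "Linf_norm f < ereal \<bar>f x\<bar>"
    by simp
  have "continuous_on (sphere 0 1) (\<lambda>x. ereal \<bar>f x\<bar>)"
    by (intro continuous_intros f)
  then obtain U where U: "open U"
      "U \<inter> sphere 0 1 = (\<lambda>x. ereal \<bar>f x\<bar>) -` {Linf_norm f<..} \<inter> sphere 0 1"
    unfolding continuous_on_open_invariant by (meson open_greaterThan)
  have "AE y in sphere_measure. ereal \<bar>f y\<bar> \<le> Linf_norm f"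
    unfolding Linf_norm_def by (rule esssup_AE)
  then have "AE y in sphere_measure. y \<notin> U"
    using AE_space
  proof eventually_elim
    case (elim y)
    have "y \<notin> U \<inter> sphere 0 1"
      unfolding U(2) using elim(1) by simp
    then show ?case
      using elim(2) by simp
  qed
  moreover have "x \<in> U"
    using U(2) less x by auto
  ultimately show False
    using AE_sphere_measure_not_open[OF U(1) x] by blast
qed

lemma spherical_harmonic_measurable:
  fixes h :: "'a::euclidean_space \<Rightarrow> real"
  assumes "spherical_harmonic l h"
  shows "h \<in> borel_measurable sphere_measure"
proof -
  obtain p where "real_polynomial_function p" "\<forall>x\<in>sphere 0 1. h x = p x"
    using assms unfolding spherical_harmonic_def by blast
  then have "continuous_on (sphere 0 1) h"
    using continuous_on_polymonial_function[of p "sphere 0 1"]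
    by (subst continuous_on_cong[OF refl, of _ h p]) (simp_all add: real_polynomial_function_eq)
  then show ?thesis
    by (rule borel_measurable_sphere_measure_continuous)
qed

text \<open>An almost everywhere bound passes to \<open>esssup\<close> only for measurable
  functions.\<close>

lemma discrete_filter_measurable:
  fixes Y :: "nat \<Rightarrow> nat \<Rightarrow> 'a::euclidean_space \<Rightarrow> real"
  assumes "harmonic_basis Z Y"
  shows "discrete_filter d Z Y \<eta> m x w f \<in> borel_measurable sphere_measure"
proof -
  have Y: "Y l k \<in> borel_measurable sphere_measure" if "k \<in> {1..Z l}" for l k
    using assms that spherical_harmonic_measurable unfolding harmonic_basis_def by blast
  show ?thesis
    unfolding discrete_filter_def multiplier_kernel_def kernel_term_def
    by (intro borel_measurable_sum borel_measurable_times borel_measurable_suminf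
        borel_measurable_const Y)
qed

section \<open>Uniform kernel means and the bound for the filter\<close>

theorem corollary5p3:
  fixes d :: nat
    and Z :: "nat \<Rightarrow> nat"
    and Y :: "nat \<Rightarrow> nat \<Rightarrow> 'a::euclidean_space \<Rightarrow> real"
    and M :: "nat set"
    and X :: "nat \<Rightarrow> nat \<Rightarrow> 'a"
    and \<eta> :: "nat \<Rightarrow> real \<Rightarrow> real"
    and L C\<^sub>L r C\<^sub>2 :: real
  assumes "d \<ge> 1"
    and "DIM('a) = d + 1"
    and "harmonic_basis Z Y"
    and "infinite M"
    and "\<And>m. m \<in> M \<Longrightarrow> m \<ge> 2"
    and "\<And>m j. m \<in> M \<Longrightarrow> j \<in> {1..m} \<Longrightarrow> X m j \<in> sphere 0 1"
    and "\<And>n x y. n \<ge> 1 \<Longrightarrow> x \<in> sphere 0 1 \<Longrightarrow> y \<in> sphere 0 1 \<Longrightarrow>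
           summable (kernel_term d Z Y (\<eta> n) x y)"
    and "L > real d + 1"
    and "\<And>n x y. n \<ge> 1 \<Longrightarrow> x \<in> sphere 0 1 \<Longrightarrow> y \<in> sphere 0 1 \<Longrightarrow>
           \<bar>multiplier_kernel d Z Y (\<eta> n) x y\<bar>
             \<le> C\<^sub>L * real n ^ d * (1 + real n * geodesic_dist x y) powr (- L)"
    and "r > real d / 2"
    and "quasi_uniform M X"
    and "qmc_designs d Z Y r M X"
    and "C\<^sub>2 > 0"
  shows "\<exists>C>0. \<forall>m\<in>M. \<forall>n\<ge>1. \<forall>f. continuous_on (sphere 0 1) f \<longrightarrow>
           real n \<le> C\<^sub>2 * real m powr (1 / real d) \<longrightarrow>
           Linf_norm (discrete_filter d Z Y (\<eta> n) m (X m) (\<lambda>j. 1 / real m) f)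
             \<le> ereal C * Linf_norm f"
proof -
  obtain C0 where C0: "\<And>m. m \<in> M \<Longrightarrow> mesh_norm m (X m) \<le> C0 * separation_radius m (X m)"
    using assms(11) unfolding quasi_uniform_def by blast
  \<comment> \<open>Chosen so that \<open>1 / (c * q)\<close> with \<open>q = m powr (1 / d)\<close>
    is a lower bound for the separation radius; \<open>\<bar>C0\<bar> + 1\<close> is positive
    whatever the sign of \<open>C0\<close>.\<close>
  define c where "c = 8 * (\<bar>C0\<bar> + 1)"
  have c: "c > 0"
    by (simp add: c_def)
  define S where "S = (\<Sum>k. real (k + 1) powr (real d - L))"
  have S: "S \<ge> 0"
    unfolding S_def using assms(8)
    by (intro suminf_nonneg summable_real_powr_shift) simp_all
  \<comment> \<open>The final 1 keeps \<open>C\<close> positive even for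
    \<open>C\<^sub>L = 0\<close>.\<close>
  define C where "C = \<bar>C\<^sub>L\<bar> * (2 * 5 ^ (d + 1) * (C\<^sub>2 + c) ^ d * S) + 1"
  have C: "C > 0"
    unfolding C_def using S c \<open>C\<^sub>2 > 0\<close> by (intro add_nonneg_pos mult_nonneg_nonneg) auto
  have kernel_sum: "1 / real m * (\<Sum>j\<in>{1..m}. \<bar>multiplier_kernel d Z Y (\<eta> n) y (X m j)\<bar>) \<le> C"
    if m: "m \<in> M" and n: "n \<ge> 1" "real n \<le> C\<^sub>2 * real m powr (1 / real d)"
      and y: "y \<in> sphere 0 1" for m n y
  proof -
    define q where "q = real m powr (1 / real d)"
    have X: "X m j \<in> sphere 0 1" if "j \<in> {1..m}" for j
      using assms(6) m that .
    have m2: "m \<ge> 2"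
      using assms(5) m .
    then have q: "q > 0" "q ^ d = real m"
      using \<open>d \<ge> 1\<close> by (simp_all add: q_def powr_power)
    define s where "s = 1 / (c * q)"
    have s: "s > 0"
      using q c by (simp add: s_def)
    have "s \<le> separation_radius m (X m)"
    proof -
      have sr: "0 \<le> separation_radius m (X m)"
        using m2 X by (rule separation_radius_nonneg)
      have "1 / (8 * q) = real m powr (- 1 / real d) / 8"
        by (simp add: q_def powr_minus_divide)
      also have "\<dots> \<le> mesh_norm m (X m)"
        using assms(1,2) m2 X by (intro mesh_norm_ge) auto
      also have "\<dots> \<le> C0 * separation_radius m (X m)"
        using C0 m .
      also have "\<dots> \<le> (\<bar>C0\<bar> + 1) * separation_radius m (X m)"
        using sr by (intro mult_right_mono) auto
      finally have "1 / (8 * q) / (\<bar>C0\<bar> + 1) \<le> separation_radius m (X m)"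
        by (subst pos_divide_le_eq) (simp_all add: mult.commute)
      then show ?thesis
        by (simp only: s_def c_def divide_divide_eq_left mult_ac)
    qed
    then have sep: "s \<le> dist (X m i) (X m j)" if "i \<in> {1..m}" "j \<in> {1..m}" "i \<noteq> j" for i j
      using separation_radius_le_dist[OF that, of "X m"] X by fastforce
    have "\<bar>multiplier_kernel d Z Y (\<eta> n) y (X m j)\<bar>
        \<le> \<bar>C\<^sub>L\<bar> * real n ^ d * (1 + real n * dist y (X m j)) powr (- L)" if j: "j \<in> {1..m}" for j
    proof -
      have "\<bar>multiplier_kernel d Z Y (\<eta> n) y (X m j)\<bar>
          \<le> C\<^sub>L * real n ^ d * (1 + real n * geodesic_dist y (X m j)) powr (- L)"
        using n y X[OF j] by (intro assms(9))
      \<comment> \<open>As the exponent is negative, the smaller Euclidean distance gives the larger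
        bound.\<close>
      also have "\<dots> \<le> \<bar>C\<^sub>L\<bar> * real n ^ d * (1 + real n * dist y (X m j)) powr (- L)"
        using dist_le_geodesic_dist[OF y X[OF j]] assms(8) n
        by (intro mult_mono powr_mono2' add_left_mono mult_left_mono mult_right_mono)
          (auto intro: add_pos_nonneg)
      finally show ?thesis .
    qed
    then have "(\<Sum>j\<in>{1..m}. \<bar>multiplier_kernel d Z Y (\<eta> n) y (X m j)\<bar>)
        \<le> \<bar>C\<^sub>L\<bar> * real n ^ d * (\<Sum>j\<in>{1..m}. (1 + real n * dist y (X m j)) powr (- L))"
      unfolding sum_distrib_left by (intro sum_mono)
    also have "\<dots> \<le> \<bar>C\<^sub>L\<bar> * real n ^ d * (2 * 5 ^ (d + 1) * (1 + 1 / (real n * s)) ^ d * S)"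
      unfolding S_def using n
      by (intro mult_left_mono sum_decay_separated_le s assms(2,8) y X sep) auto
    also have "\<dots> = \<bar>C\<^sub>L\<bar> * (2 * 5 ^ (d + 1) * (real n * (1 + 1 / (real n * s))) ^ d * S)"
      by (simp add: power_mult_distrib)
    \<comment> \<open>The factor \<open>n ^ d\<close> has been absorbed into the power. As
      \<open>n \<le> C\<^sub>2 * q\<close>, the new base is at most
      \<open>(C\<^sub>2 + c) * q\<close>, and \<open>q ^ d = m\<close> cancels the weight
      \<open>1 / m\<close>.\<close>
    also have "real n * (1 + 1 / (real n * s)) = real n + c * q"
      using n by (simp add: s_def algebra_simps)
    also have "\<bar>C\<^sub>L\<bar> * (2 * 5 ^ (d + 1) * (real n + c * q) ^ d * S)
        \<le> \<bar>C\<^sub>L\<bar> * (2 * 5 ^ (d + 1) * ((C\<^sub>2 + c) * q) ^ d * S)"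
      using n(2) c q S
      by (intro mult_left_mono mult_right_mono power_mono) (auto simp: q_def algebra_simps)
    also have "\<dots> = real m * (C - 1)"
      by (simp add: C_def power_mult_distrib q)
    finally show ?thesis
      using m2 by (simp add: field_simps)
  qed
  show ?thesis
  proof (intro exI[of _ C] conjI C ballI allI impI)
    fix m n and f :: "'a \<Rightarrow> real"
    assume m: "m \<in> M" and n: "n \<ge> 1" "real n \<le> C\<^sub>2 * real m powr (1 / real d)"
      and f: "continuous_on (sphere 0 1) f"
    let ?F = "discrete_filter d Z Y (\<eta> n) m (X m) (\<lambda>j. 1 / real m) f"
    have X: "X m j \<in> sphere 0 1" if "j \<in> {1..m}" for j
      using assms(6) m that .
    have "ereal \<bar>?F y\<bar> \<le> ereal C * Linf_norm f" if y: "y \<in> sphere 0 1" for y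
    \<comment> \<open>The norm is an extended real: the value \<infinity> is trivial since
      \<open>C > 0\<close>, and -\<infinity> contradicts the pointwise bound.\<close>
    proof (cases "Linf_norm f")
      case (real a)
      have a: "\<bar>f x\<bar> \<le> a" if "x \<in> sphere 0 1" for x
        using continuous_le_Linf_norm[OF f that] real by simp
      have "\<bar>?F y\<bar> \<le> (\<Sum>j\<in>{1..m}. 1 / real m * a * \<bar>multiplier_kernel d Z Y (\<eta> n) y (X m j)\<bar>)"
        unfolding discrete_filter_def
        by (intro sum_abs[THEN order_trans] sum_mono)
          (auto simp: abs_mult intro!: mult_right_mono divide_right_mono a X)
      also have "\<dots> = a * (1 / real m * (\<Sum>j\<in>{1..m}. \<bar>multiplier_kernel d Z Y (\<eta> n) y (X m j)\<bar>))"
        by (simp add: sum_distrib_left mult_ac)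
      also have "\<dots> \<le> a * C"
        using a[OF y] by (intro mult_left_mono kernel_sum m n y) auto
      finally show ?thesis
        using real by (simp add: mult.commute)
    next
      case PInf
      then show ?thesis
        using C by simp
    next
      case MInf
      then show ?thesis
        using continuous_le_Linf_norm[OF f y] by simp
    qed
    then have "AE y in sphere_measure. ereal \<bar>?F y\<bar> \<le> ereal C * Linf_norm f"
      by (intro AE_I2) simp
    moreover have "(\<lambda>y. ereal \<bar>?F y\<bar>) \<in> borel_measurable sphere_measure"
      using discrete_filter_measurable[OF assms(3)] by measurable
    ultimately show "Linf_norm ?F \<le> ereal C * Linf_norm f"
      unfolding Linf_norm_def[of ?F] by (intro esssup_I)
  qed
qed

end
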